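(* Fix $x\in\mathcal X$ and $b\in(0,1]$ with $q(x,b)>0$. Let $\kappa(x,b):=\mathbb P_{y\sim\pi_{\mathrm{ref}}^\sharp(\cdot\mid x)}[y\in B(x,b)]$. Then every policy $\pi(\cdot\mid x)\ll\pi_{\mathrm{ref}}^\sharp(\cdot\mid x)$ satisfies $$\left|\mathbb P_{y\sim\pi(\cdot\mid x)}[y\in B(x,b)]-\kappa(x,b)\right|\le\sqrt{\bigl(C_\pi^\sharp(x)-1\bigr)\,\kappa(x,b)\,\bigl(1-\kappa(x,b)\bigr)}.$$ Moreover, with $\bar\varepsilon_g(x):=\sqrt{\mathbb E_{y\sim\pi_{\mathrm{ref}}(\cdot\mid x)}\left[(\widehat g(x,y)-g^\star(x,y))^2\right]}$, $$\kappa(x,b)\le\min\left\{1,\ \frac{\bar\varepsilon_g(x)^2}{b^2\,q(x,b)}\right\}.$$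
   Context: Setting. $\mathcal X$ is a set of prompts and $\mathcal Y$ is a finite or countable set of outputs. $\pi_{\mathrm{ref}}(\cdot\mid x)$ is a probability distribution on $\mathcal Y$ (reference policy); a policy $\pi(\cdot\mid x)$ is any probability distribution on $\mathcal Y$. $g^\star:\mathcal X\times\mathcal Y\to\{0,1\}$ is the true safety function ($1$ = safe) and $\widehat g:\mathcal X\times\mathcal Y\to[0,1]$ is a learned safety proxy. The proxy-feasible set is $\widehat{\mathcal S}_+(x,b)=\{y\in\mathcal Y:\widehat g(x,y)\ge b\}$, and $B(x,b)=\{y\in\widehat{\mathcal S}_+(x,b): g^\star(x,y)=0\}$. $q(x,b)=\mathbb P_{y\sim\pi_{\mathrm{ref}}(\cdot\mid x)}[y\in\widehat{\mathcal S}_+(x,b)]$, and the proxy-feasible reference distribution is $\pi_{\mathrm{ref}}^\sharp(y\mid x)=\pi_{\mathrm{ref}}(y\mid x)\,\mathbb I\{y\in\widehat{\mathcal S}_+(x,b)\}/q(x,b)$. $\pi(\cdot\mid x)\ll\pi_{\mathrm{ref}}^\sharp(\cdot\mid x)$ means that $\pi(y\mid x)>0$ implies $\pi_{\mathrm{ref}}^\sharp(y\mid x)>0$ for every $y$. For such $\pi$, the coverage coefficient is $C_\pi^\sharp(x)=\sum_{y\in\mathcal Y}\pi(y\mid x)^2/\pi_{\mathrm{ref}}^\sharp(y\mid x)=1+\chi^2(\pi(\cdot\mid x)\,\|\,\pi_{\mathrm{ref}}^\sharp(\cdot\mid x))\in[1,\infty]$, where terms with $0/0$ are read as $0$ and,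 if $C_\pi^\sharp(x)=\infty$, products $\infty\cdot0$ are read as $0$. *)

theory Defs
  imports "HOL-Probability.Probability"
begin

definition proxy_feasible :: "('x \<Rightarrow> 'y \<Rightarrow> real) \<Rightarrow> 'x \<Rightarrow> real \<Rightarrow> 'y set" where
  "proxy_feasible ghat x b = {y. ghat x y \<ge> b}"

definition proxy_bad :: "('x \<Rightarrow> 'y \<Rightarrow> real) \<Rightarrow> ('x \<Rightarrow> 'y \<Rightarrow> real) \<Rightarrow> 'x \<Rightarrow> real \<Rightarrow> 'y set" where
  "proxy_bad gstar ghat x b = {y \<in> proxy_feasible ghat x b. gstar x y = 0}"

definition feasible_mass ::
  "('x \<Rightarrow> 'y pmf) \<Rightarrow> ('x \<Rightarrow> 'y \<Rightarrow> real) \<Rightarrow> 'x \<Rightarrow> real \<Rightarrow> real" where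
  "feasible_mass piref ghat x b = measure_pmf.prob (piref x) (proxy_feasible ghat x b)"

text \<open>The conditional distribution is specified only if the feasible mass is positive;
  \<open>pmf_ref_sharp\<close> below gives the explicit density in that case.\<close>

definition ref_sharp ::
  "('x \<Rightarrow> 'y pmf) \<Rightarrow> ('x \<Rightarrow> 'y \<Rightarrow> real) \<Rightarrow> real \<Rightarrow> 'x \<Rightarrow> 'y pmf" where
  "ref_sharp piref ghat b x = cond_pmf (piref x) (proxy_feasible ghat x b)"

lemma pmf_ref_sharp:
  assumes "feasible_mass piref ghat x b > 0"
  shows "pmf (ref_sharp piref ghat b x) y =
    pmf (piref x) y * indicator (proxy_feasible ghat x b) y / feasible_mass piref ghat x b"
proof -
  have "set_pmf (piref x) \<inter> proxy_feasible ghat x b \<noteq> {}"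
    using assms by (auto simp: feasible_mass_def measure_pmf_zero_iff[symmetric])
  then show ?thesis
    by (simp add: ref_sharp_def feasible_mass_def pmf_cond indicator_def)
qed

definition abs_cont_pmf :: "'y pmf \<Rightarrow> 'y pmf \<Rightarrow> bool" where
  "abs_cont_pmf p r \<longleftrightarrow> (\<forall>y. pmf p y > 0 \<longrightarrow> pmf r y > 0)"

text \<open>A sum of nonnegative terms over all outputs, written as an integral over the counting
  measure; in \<^typ>\<open>ennreal\<close>, \<open>0 / 0 = 0\<close>. The result is coerced to
  \<^typ>\<open>ereal\<close> so that subtracting 1 is not truncated.\<close>

definition coverage :: "'y pmf \<Rightarrow> 'y pmf \<Rightarrow> ereal" where
  "coverage p r =
    enn2ereal (\<integral>\<^sup>+ y. (ennreal (pmf p y))\<^sup>2 / ennreal (pmf r y) \<partial>count_space UNIV)"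

text \<open>Square root on \<open>[0, \<infinity>]\<close>; values at negative arguments are irrelevant.\<close>

definition ereal_sqrt :: "ereal \<Rightarrow> ereal" where
  "ereal_sqrt z = (if z = \<infinity> then \<infinity> else ereal (sqrt (real_of_ereal z)))"

definition kappa ::
  "('x \<Rightarrow> 'y pmf) \<Rightarrow> ('x \<Rightarrow> 'y \<Rightarrow> real) \<Rightarrow> ('x \<Rightarrow> 'y \<Rightarrow> real) \<Rightarrow> 'x \<Rightarrow> real \<Rightarrow> real" where
  "kappa piref gstar ghat x b =
    measure_pmf.prob (ref_sharp piref ghat b x) (proxy_bad gstar ghat x b)"

definition rms_proxy_error ::
  "('x \<Rightarrow> 'y pmf) \<Rightarrow> ('x \<Rightarrow> 'y \<Rightarrow> real) \<Rightarrow> ('x \<Rightarrow> 'y \<Rightarrow> real) \<Rightarrow> 'x \<Rightarrow> real" where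
  "rms_proxy_error piref gstar ghat x =
    sqrt (measure_pmf.expectation (piref x) (\<lambda>y. (ghat x y - gstar x y)\<^sup>2))"

end

theory Submission
  imports Defs
begin

text \<open>Coarsening to the event \<open>A\<close> and its complement can only decrease the \<open>\<chi>\<^sup>2\<close>-divergence. On each
  of the two cells this is the tangent-line bound \<open>p\<^sup>2 / r \<ge> 2 c p - c\<^sup>2 r\<close>, summed with \<open>c\<close>
  the quotient of the cell masses. With masses \<open>t\<close> and \<open>k\<close> of \<open>A\<close>, the coarsened divergence is
  \<open>(t - k)\<^sup>2 / (k (1 - k))\<close>. The bound on \<open>\<kappa>\<close> is Markov's inequality, as the squared proxy error
  is at least \<open>b\<^sup>2\<close> on the bad set.\<close>

text \<open>This is \<open>(p - c * r)\<^sup>2 / r\<close> \<ge> 0 expanded. The term with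
  \<open>c\<^sup>2\<close> stays on the right because subtraction in \<open>ennreal\<close>
  truncates.\<close>

lemma ennreal_pmf_square_div_tangent:
  fixes c :: real
  assumes "0 \<le> c"
  shows "ennreal (2 * c) * ennreal (pmf p y)
    \<le> (ennreal (pmf p y))\<^sup>2 / ennreal (pmf r y) + ennreal (c\<^sup>2) * ennreal (pmf r y)"
proof (cases "pmf r y = 0")
  case True
  \<comment> \<open>With zero denominator the quotient is infinite if \<open>pmf p y\<close> is
    positive; otherwise it is 0 / 0 = 0 and the left side vanishes too.\<close>
  then show ?thesis
    by (cases "pmf p y = 0") (auto simp: ennreal_power ennreal_divide_zero power2_eq_square
        ennreal_mult_eq_top_iff ennreal_zero_less_mult_iff ennreal_divide_eq_top_iff)
next
  case False
  then have r: "pmf r y > 0"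
    using pmf_nonneg[of r y] by linarith
  have "0 \<le> (pmf p y - c * pmf r y)\<^sup>2 / pmf r y"
    using r by simp
  also have "\<dots> = (pmf p y)\<^sup>2 / pmf r y + c\<^sup>2 * pmf r y - 2 * c * pmf p y"
    using r by (simp add: field_simps power2_eq_square)
  finally have "2 * c * pmf p y \<le> (pmf p y)\<^sup>2 / pmf r y + c\<^sup>2 * pmf r y"
    by simp
  then have "ennreal (2 * c * pmf p y) \<le> ennreal ((pmf p y)\<^sup>2 / pmf r y + c\<^sup>2 * pmf r y)"
    by (rule ennreal_leI)
  then show ?thesis
    using assms r by (simp add: ennreal_mult ennreal_power divide_ennreal)
qed

lemma nn_integral_pmf_cell:
  assumes "0 \<le> c"
  shows "(\<integral>\<^sup>+ y. ennreal c * ennreal (pmf p y) * indicator A y \<partial>count_space UNIV)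
    = ennreal (c * measure_pmf.prob p A)"
proof -
  have "(\<integral>\<^sup>+ y. ennreal c * ennreal (pmf p y) * indicator A y \<partial>count_space UNIV)
      = (\<integral>\<^sup>+ y. ennreal c * indicator A y \<partial>measure_pmf p)"
    by (simp add: nn_integral_measure_pmf mult_ac)
  also have "\<dots> = ennreal c * emeasure (measure_pmf p) A"
    by (simp add: nn_integral_cmult)
  finally show ?thesis
    using assms by (simp add: measure_pmf.emeasure_eq_measure ennreal_mult)
qed

lemma prob_square_div_le_nn_integral:
  assumes k: "measure_pmf.prob r A > 0"
  shows "ennreal ((measure_pmf.prob p A)\<^sup>2 / measure_pmf.prob r A)
    \<le> (\<integral>\<^sup>+ y. (ennreal (pmf p y))\<^sup>2 / ennreal (pmf r y) * indicator A y \<partial>count_space UNIV)"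
    (is "ennreal ?D \<le> ?I")
proof -
  define c where "c = measure_pmf.prob p A / measure_pmf.prob r A"
  have c: "c \<ge> 0"
    by (simp add: c_def)
  \<comment> \<open>The slope \<open>c\<close> maximizes 2 c t - c^2 k for the cell masses t under
    \<open>p\<close> and k under \<open>r\<close>: then 2 c t is twice \<open>?D\<close> and c^2 k
    is \<open>?D\<close>. The tangent bound thus sums to \<open>?D + ?D\<close> \<le>
    \<open>?I + ?D\<close>, and the finite \<open>?D\<close> cancels even if \<open>?I\<close> is
    infinite.\<close>
  have "ennreal ?D + ennreal ?D = ennreal (2 * c * measure_pmf.prob p A)"
    by (simp add: c_def power2_eq_square flip: ennreal_plus)
  also have "\<dots> = (\<integral>\<^sup>+ y. ennreal (2 * c) * ennreal (pmf p y) * indicator A y \<partial>count_space UNIV)"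
    using c by (simp add: nn_integral_pmf_cell)
  also have "\<dots> \<le> (\<integral>\<^sup>+ y. (ennreal (pmf p y))\<^sup>2 / ennreal (pmf r y) * indicator A y
      + ennreal (c\<^sup>2) * ennreal (pmf r y) * indicator A y \<partial>count_space UNIV)"
    by (intro nn_integral_mono)
      (use ennreal_pmf_square_div_tangent[OF c] in \<open>auto split: split_indicator\<close>)
  also have "\<dots> = ?I + ennreal (c\<^sup>2 * measure_pmf.prob r A)"
    by (simp add: nn_integral_add nn_integral_pmf_cell)
  also have "c\<^sup>2 * measure_pmf.prob r A = ?D"
    using k by (simp add: c_def power2_eq_square)
  finally show ?thesis
    by (simp add: add.commute ennreal_add_left_cancel_le)
qed

lemma coverage_ge:
  assumes k: "0 < measure_pmf.prob r A" "measure_pmf.prob r A < 1"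
  shows "ereal (1 + (measure_pmf.prob p A - measure_pmf.prob r A)\<^sup>2
      / (measure_pmf.prob r A * (1 - measure_pmf.prob r A))) \<le> coverage p r"
proof -
  let ?f = "\<lambda>y. (ennreal (pmf p y))\<^sup>2 / ennreal (pmf r y)"
  let ?k = "measure_pmf.prob r A" and ?t = "measure_pmf.prob p A"
  have compl: "measure_pmf.prob s (- A) = 1 - measure_pmf.prob s A" for s
    using measure_pmf.prob_compl[of A s] by (simp add: Compl_eq_Diff_UNIV)
  \<comment> \<open>With d = t - k, the two quotients are k + 2 d + d^2 / k and (1 - k) - 2 d + d^2
    / (1 - k); the linear terms cancel in the sum.\<close>
  have D: "?t\<^sup>2 / ?k + (1 - ?t)\<^sup>2 / (1 - ?k) = 1 + (?t - ?k)\<^sup>2 / (?k * (1 - ?k))"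
    using k by (simp add: divide_simps) algebra
  have "ennreal (?t\<^sup>2 / ?k + (1 - ?t)\<^sup>2 / (1 - ?k))
      = ennreal (?t\<^sup>2 / ?k) + ennreal ((1 - ?t)\<^sup>2 / (1 - ?k))"
    using k by (intro ennreal_plus) auto
  also have "\<dots> \<le> (\<integral>\<^sup>+ y. ?f y * indicator A y \<partial>count_space UNIV)
      + (\<integral>\<^sup>+ y. ?f y * indicator (- A) y \<partial>count_space UNIV)"
    using prob_square_div_le_nn_integral[of r A p] prob_square_div_le_nn_integral[of r "- A" p] k
    by (intro add_mono) (auto simp: compl)
  also have "\<dots> = (\<integral>\<^sup>+ y. ?f y \<partial>count_space UNIV)"
    by (subst nn_integral_add[symmetric])
      (auto intro!: nn_integral_cong split: split_indicator)
  finally have "enn2ereal (ennreal (1 + (?t - ?k)\<^sup>2 / (?k * (1 - ?k)))) \<le> coverage p r"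
    unfolding D coverage_def by (simp only: less_eq_ennreal.rep_eq)
  then show ?thesis
    using k by (simp add: enn2ereal_ennreal del: ennreal_plus)
qed

lemma prob_eq_0_if_abs_cont:
  assumes "abs_cont_pmf p r" "measure_pmf.prob r A = 0"
  shows "measure_pmf.prob p A = 0"
  using assms
  by (auto simp: abs_cont_pmf_def measure_pmf_zero_iff disjoint_iff pmf_positive_iff)

lemma abs_prob_diff_le_coverage:
  assumes ac: "abs_cont_pmf p r"
  shows "ereal \<bar>measure_pmf.prob p A - measure_pmf.prob r A\<bar>
    \<le> ereal_sqrt ((coverage p r - 1) * ereal (measure_pmf.prob r A)
        * ereal (1 - measure_pmf.prob r A))"
proof -
  let ?k = "measure_pmf.prob r A" and ?t = "measure_pmf.prob p A"
  have compl: "measure_pmf.prob s (- A) = 1 - measure_pmf.prob s A" for s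
    using measure_pmf.prob_compl[of A s] by (simp add: Compl_eq_Diff_UNIV)
  consider "?k = 0" | "?k = 1" | "0 < ?k" "?k < 1"
    using measure_pmf.prob_le_1[of r A] measure_nonneg[of r A] by linarith
  then show ?thesis
  proof cases
    \<comment> \<open>In the degenerate cases k = 0 and k = 1 absolute continuity, applied to
      \<open>A\<close> or to its complement, forces t = k. The right side is then 0 even for
      infinite coverage, since infinity times 0 is 0 in \<open>ereal\<close>.\<close>
    case 1
    with prob_eq_0_if_abs_cont[OF ac, of A] show ?thesis
      by (simp add: ereal_sqrt_def)
  next
    case 2
    with prob_eq_0_if_abs_cont[OF ac, of "- A"] show ?thesis
      by (simp add: ereal_sqrt_def compl)
  next
    case 3
    let ?d = "(?t - ?k)\<^sup>2 / (?k * (1 - ?k))"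
    have cov: "ereal (1 + ?d) \<le> coverage p r"
      using 3 by (rule coverage_ge)
    show ?thesis
    proof (cases "coverage p r")
      case (real c)
      with cov have "?d \<le> c - 1"
        by simp
      with 3 have "(?t - ?k)\<^sup>2 \<le> (c - 1) * ?k * (1 - ?k)"
        by (simp add: pos_divide_le_eq mult.assoc)
      then have "\<bar>?t - ?k\<bar> \<le> sqrt ((c - 1) * ?k * (1 - ?k))"
        by (simp add: real_le_rsqrt)
      with real show ?thesis
        by (simp add: ereal_sqrt_def one_ereal_def)
    next
      \<comment> \<open>Here both k and 1 - k are positive, so the product is infinite and so is its
        \<open>ereal_sqrt\<close>.\<close>
      case PInf
      with 3 show ?thesis
        by (simp add: ereal_sqrt_def)
    next
      case MInf
      with cov show ?thesis
        by simp
    qed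
  qed
qed

text \<open>Inside the feasible set conditioning only rescales. This turns \<open>kappa\<close> into
  a probability under \<open>piref x\<close>, the distribution over which the proxy error is
  averaged.\<close>

lemma prob_ref_sharp:
  assumes q: "feasible_mass piref ghat x b > 0" and A: "A \<subseteq> proxy_feasible ghat x b"
  shows "measure_pmf.prob (ref_sharp piref ghat b x) A
    = measure_pmf.prob (piref x) A / feasible_mass piref ghat x b"
proof -
  have "set_pmf (piref x) \<inter> proxy_feasible ghat x b \<noteq> {}"
    using q by (auto simp: feasible_mass_def measure_pmf_zero_iff[symmetric])
  then show ?thesis
    using A q by (simp add: ref_sharp_def feasible_mass_def cond_pmf.rep_eq Int_absorb1
        measure_pmf.emeasure_eq_measure)
qed

lemma kappa_le:
  assumes gstar: "\<And>y. gstar x y \<in> {0, 1}"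
    and ghat: "\<And>y. ghat x y \<in> {0..1}"
    and b: "0 < b"
    and q: "feasible_mass piref ghat x b > 0"
  shows "kappa piref gstar ghat x b
    \<le> (rms_proxy_error piref gstar ghat x)\<^sup>2 / (b\<^sup>2 * feasible_mass piref ghat x b)"
proof -
  let ?B = "proxy_bad gstar ghat x b" and ?err = "\<lambda>y. (ghat x y - gstar x y)\<^sup>2"
  \<comment> \<open>Both functions take values in [0, 1]. The bound gives integrability of the
    error, which monotonicity of the Bochner integral requires: a non-integrable function would have
    integral 0 by default.\<close>
  have "?err y \<le> 1" for y
    using gstar[of y] ghat[of y] by (auto simp: abs_square_le_1)
  then have int: "integrable (measure_pmf (piref x)) ?err"
    by (intro measure_pmf.integrable_const_bound[where B = 1]) auto
  have "b\<^sup>2 * measure_pmf.prob (piref x) ?B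
      = measure_pmf.expectation (piref x) (\<lambda>y. b\<^sup>2 * indicator ?B y)"
    by simp
  also have "\<dots> \<le> measure_pmf.expectation (piref x) ?err"
  proof (rule integral_mono)
    show "b\<^sup>2 * indicator ?B y \<le> ?err y" for y
      using b by (auto simp: proxy_bad_def proxy_feasible_def indicator_def intro: power_mono)
  qed (use int in \<open>auto simp: measure_pmf.emeasure_eq_measure
      intro!: integrable_mult_right integrable_real_indicator\<close>)
  also have "\<dots> = (rms_proxy_error piref gstar ghat x)\<^sup>2"
    by (simp add: rms_proxy_error_def)
  finally have "measure_pmf.prob (piref x) ?B \<le> (rms_proxy_error piref gstar ghat x)\<^sup>2 / b\<^sup>2"
    using b by (simp add: field_simps)
  moreover have "kappa piref gstar ghat x b
      = measure_pmf.prob (piref x) ?B / feasible_mass piref ghat x b"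
    unfolding kappa_def by (rule prob_ref_sharp[OF q]) (auto simp: proxy_bad_def)
  ultimately show ?thesis
    using q by (simp add: divide_right_mono flip: divide_divide_eq_left)
qed

theorem theorem5p1:
  fixes piref :: "'x \<Rightarrow> 'y::countable pmf"
    and gstar ghat :: "'x \<Rightarrow> 'y \<Rightarrow> real"
    and x :: 'x and b :: real
  assumes gstar: "\<And>x y. gstar x y \<in> {0, 1}"
    and ghat: "\<And>x y. ghat x y \<in> {0..1}"
    and b: "b \<in> {0<..1}"
    and q: "feasible_mass piref ghat x b > 0"
  shows "(\<forall>\<pi> :: 'x \<Rightarrow> 'y pmf. abs_cont_pmf (\<pi> x) (ref_sharp piref ghat b x) \<longrightarrow>
      ereal \<bar>measure_pmf.prob (\<pi> x) (proxy_bad gstar ghat x b) - kappa piref gstar ghat x b\<bar>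
        \<le> ereal_sqrt ((coverage (\<pi> x) (ref_sharp piref ghat b x) - 1)
            * ereal (kappa piref gstar ghat x b) * ereal (1 - kappa piref gstar ghat x b)))
    \<and> kappa piref gstar ghat x b
        \<le> min 1 ((rms_proxy_error piref gstar ghat x)\<^sup>2 / (b\<^sup>2 * feasible_mass piref ghat x b))"
proof (intro conjI allI impI min.boundedI)
  show "kappa piref gstar ghat x b \<le> 1"
    by (simp add: kappa_def)
qed (use assms kappa_le[of gstar x ghat b piref] abs_prob_diff_le_coverage in \<open>auto simp: kappa_def\<close>)

end
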